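(* Let $Q$ be a query joining two tables $T_1$ and $T_2$ on $T_1.a=T_2.a'$, with filter expression $\theta_1$ on $T_1$ and filter expression $\theta_2$ on $T_2$. With the plan costs $$Cost(\theta_1(T_1)\bowtie\theta_2(T_2))=\sum_{i=1}^{|T_1|}\mathcal{C}_1^i+p_1\sum_{i=1}^{|T_1|}c_a^i+\sum_{i=1}^{|T_2|}\mathcal{C}_2^i+p_2\sum_{i=1}^{|T_2|}c_{a'}^i,$$ $$Cost(\theta_1(T_1)\rightarrow\hat\theta_2(T_2))=\sum_{i=1}^{|T_1|}\mathcal{C}_1^i+p_1\sum_{i=1}^{|T_1|}c_a^i+\sum_{i=1}^{|T_2|}\hat{\mathcal{C}}_2^i,$$ $$Cost(\theta_2(T_2)\rightarrow\hat\theta_1(T_1))=\sum_{i=1}^{|T_2|}\mathcal{C}_2^i+p_2\sum_{i=1}^{|T_2|}c_{a'}^i+\sum_{i=1}^{|T_1|}\hat{\mathcal{C}}_1^i,$$ where all quantities are as defined in the context, one always has $$Cost(\theta_1(T_1)\bowtie\theta_2(T_2))\ge Cost(\theta_1(T_1)\rightarrow\hat\theta_2(T_2))$$ and $$Cost(\theta_1(T_1)\bowtie\theta_2(T_2))\ge Cost(\theta_2(T_2)\rightarrow\hat\theta_1(T_1)).$$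
   Context: A table $T_t$ ($t=1,2$) is a finite collection of $|T_t|$ documents. A filter is a predicate on an attribute; it has a selectivity in $[0,1]$ (the probability that it returns True) and, for each document, a nonnegative cost (that of extracting its attribute from that document). A filter expression is a finite nonempty Boolean expression built from filters with AND and OR, represented as an expression tree: leaves are single filters, and each internal node is an AND or an OR of its children (nested operators of the same type are merged into one node, so a child of an AND node is not itself an AND node, and likewise for OR). Probabilities: the probability $p_\vartheta$ that an expression $\vartheta$ is True is the selectivity of the filter for a leaf, the product $\prod_j p_{\vartheta_j}$ over the children for an AND node, and $1-\prod_j(1-p_{\vartheta_j})$ for an OR node. Optimal expected cost: for a fixed document, the optimal expected cost $\mathcal{C}^*(\vartheta)$ is defined recursively: for a single filter it is the cost of that filter on the document; for a node with children $\vartheta_1,\dots,\vartheta_m$ it is $$\min_{o}\sum_{i=1}^m \mathcal{C}^*(o[i])\prod_{j=1}^{i-1}p_{o[j]}\ \text{ (AND)},\qquad \min_{o}\sum_{i=1}^m \mathcal{C}^*(o[i])\prod_{j=1}^{i-1}(1-p_{o[j]})\ \text{ (OR)},$$ the minimum being over all orders (permutations) $o$ of the children, with $o[i]$ the $i$-th child in the order. Plan quantities: $\mathcal{C}_t^i=\mathcal{C}^*(\theta_t)$ on the $i$-th document of $T_t$; $p_t=p_{\theta_t}$ is the probability that $\theta_t$ is True, i.e. that the join attribute must be extracted after performing $\theta_t$; $c_a^i$ (resp. $c_{a'}^i$) $\ge 0$ is the cost of extracting the join attribute $a$ (resp. $a'$) from the $i$-th document of $T_1$ (resp. $T_2$).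 Join transformation: the join is turned into an IN filter on one of the tables. $\hat\theta_2=(a'\ \mathrm{IN}\ V)\ \mathrm{AND}\ \theta_2$, where $V$ is the set of values of $a$ extracted from the documents of $T_1$ satisfying $\theta_1$; this IN filter has some selectivity in $[0,1]$ and cost $c_{a'}^i$ on the $i$-th document of $T_2$. Symmetrically $\hat\theta_1=(a\ \mathrm{IN}\ V')\ \mathrm{AND}\ \theta_1$, where $V'$ is the set of values of $a'$ extracted from the documents of $T_2$ satisfying $\theta_2$; this IN filter has some selectivity in $[0,1]$ and cost $c_a^i$ on the $i$-th document of $T_1$. $\hat{\mathcal{C}}_t^i=\mathcal{C}^*(\hat\theta_t)$ on the $i$-th document of $T_t$, i.e. the optimal expected cost when the IN filter is ordered together with the filters of $\theta_t$ (if the root of $\theta_t$ is an AND node, the IN filter becomes an additional child of that node; otherwise $\hat\theta_t$ is an AND node with the two children IN filter and $\theta_t$). The first cost is that of Plan 1 (push $\theta_1$ to $T_1$ and $\theta_2$ to $T_2$, then join), the second that of Plan 2 (execute $\theta_1$ on $T_1$, then transform the join into an IN filter on $T_2$), the third that of Plan 3 (execute $\theta_2$ on $T_2$, then transform the join into an IN filter on $T_1$). *)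

theory Defs
  imports Complex_Main "HOL-Combinatorics.Permutations"
begin

(* Extraction costs are per document and attribute; the cost of a filter on a document is the
   extraction cost of the attribute it inspects. *)

record ('doc, 'attr, 'val) table =
  docs :: "'doc list"
  val_of :: "'doc \<Rightarrow> 'attr \<Rightarrow> 'val"
  ext_cost :: "'doc \<Rightarrow> 'attr \<Rightarrow> real"

record ('attr, 'val) attr_filter =
  attr :: 'attr
  pred :: "'val \<Rightarrow> bool"
  sel :: real

datatype (leaves: 'f) expr =
    is_Leaf: Leaf 'f
  | is_And: And "'f expr list"
  | is_Or: Or "'f expr list"

type_synonym ('attr, 'val) filter_expr = "('attr, 'val) attr_filter expr"

fun merged :: "'f expr \<Rightarrow> bool" where
  "merged (Leaf f) \<longleftrightarrow> True"
| "merged (And es) \<longleftrightarrow> es \<noteq> [] \<and> (\<forall>e\<in>set es. merged e \<and> \<not> is_And e)"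
| "merged (Or es) \<longleftrightarrow> es \<noteq> [] \<and> (\<forall>e\<in>set es. merged e \<and> \<not> is_Or e)"

definition is_filter_expr :: "('attr, 'val) filter_expr \<Rightarrow> bool" where
  "is_filter_expr \<theta> \<longleftrightarrow> merged \<theta> \<and> (\<forall>f\<in>leaves \<theta>. 0 \<le> sel f \<and> sel f \<le> 1)"

definition is_table :: "('doc, 'attr, 'val) table \<Rightarrow> bool" where
  "is_table T \<longleftrightarrow> (\<forall>d\<in>set (docs T). \<forall>x. 0 \<le> ext_cost T d x)"

fun holds :: "('doc, 'attr, 'val) table \<Rightarrow> 'doc \<Rightarrow> ('attr, 'val) filter_expr \<Rightarrow> bool" where
  "holds T d (Leaf f) \<longleftrightarrow> pred f (val_of T d (attr f))"
| "holds T d (And es) \<longleftrightarrow> (\<forall>e\<in>set es. holds T d e)"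
| "holds T d (Or es) \<longleftrightarrow> (\<exists>e\<in>set es. holds T d e)"

primrec prob :: "('attr, 'val) filter_expr \<Rightarrow> real" where
  "prob (Leaf f) = sel f"
| "prob (And es) = prod_list (map prob es)"
| "prob (Or es) = 1 - (\<Prod>p\<leftarrow>map prob es. 1 - p)"

(* Children are processed in the order \<sigma>; cs are their costs and qs their probabilities of letting
   evaluation continue with the next child: being True under AND, being False under OR. *)

definition order_cost :: "real list \<Rightarrow> real list \<Rightarrow> (nat \<Rightarrow> nat) \<Rightarrow> real" where
  "order_cost cs qs \<sigma> = (\<Sum>i<length cs. cs ! \<sigma> i * (\<Prod>j<i. qs ! \<sigma> j))"

definition min_order_cost :: "real list \<Rightarrow> real list \<Rightarrow> real" where
  "min_order_cost cs qs = Min (order_cost cs qs ` {\<sigma>. \<sigma> permutes {..<length cs}})"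

primrec opt_cost ::
  "('doc, 'attr, 'val) table \<Rightarrow> 'doc \<Rightarrow> ('attr, 'val) filter_expr \<Rightarrow> real" where
  "opt_cost T d (Leaf f) = ext_cost T d (attr f)"
| "opt_cost T d (And es) = min_order_cost (map (opt_cost T d) es) (map prob es)"
| "opt_cost T d (Or es) = min_order_cost (map (opt_cost T d) es) (map (\<lambda>e. 1 - prob e) es)"

fun conj_filter :: "'f \<Rightarrow> 'f expr \<Rightarrow> 'f expr" where
  "conj_filter f (And es) = And (Leaf f # es)"
| "conj_filter f \<theta> = And [Leaf f, \<theta>]"

definition join_values ::
  "('doc, 'attr, 'val) table \<Rightarrow> ('attr, 'val) filter_expr \<Rightarrow> 'attr \<Rightarrow> 'val set" where
  "join_values T \<theta> a = {val_of T d a | d. d \<in> set (docs T) \<and> holds T d \<theta>}"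

(* The selectivity s of an IN filter is a free parameter, as for every other filter. *)

definition in_filter :: "'attr \<Rightarrow> 'val set \<Rightarrow> real \<Rightarrow> ('attr, 'val) attr_filter" where
  "in_filter a V s = \<lparr>attr = a, pred = (\<lambda>v. v \<in> V), sel = s\<rparr>"

definition table_cost ::
  "('doc, 'attr, 'val) table \<Rightarrow> ('attr, 'val) filter_expr \<Rightarrow> real" where
  "table_cost T \<theta> = (\<Sum>d\<leftarrow>docs T. opt_cost T d \<theta>)"

definition attr_cost :: "('doc, 'attr, 'val) table \<Rightarrow> 'attr \<Rightarrow> real" where
  "attr_cost T a = (\<Sum>d\<leftarrow>docs T. ext_cost T d a)"

definition cost_join ::
  "('d1, 'a1, 'val) table \<Rightarrow> ('a1, 'val) filter_expr \<Rightarrow> 'a1 \<Rightarrow>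
   ('d2, 'a2, 'val) table \<Rightarrow> ('a2, 'val) filter_expr \<Rightarrow> 'a2 \<Rightarrow> real" where
  "cost_join T1 \<theta>1 a1 T2 \<theta>2 a2 =
     table_cost T1 \<theta>1 + prob \<theta>1 * attr_cost T1 a1 +
     table_cost T2 \<theta>2 + prob \<theta>2 * attr_cost T2 a2"

(* The first table is filtered first; the join becomes an IN filter of selectivity s on the second. *)

definition cost_in ::
  "('d1, 'a1, 'val) table \<Rightarrow> ('a1, 'val) filter_expr \<Rightarrow> 'a1 \<Rightarrow>
   ('d2, 'a2, 'val) table \<Rightarrow> ('a2, 'val) filter_expr \<Rightarrow> 'a2 \<Rightarrow> real \<Rightarrow> real" where
  "cost_in T1 \<theta>1 a1 T2 \<theta>2 a2 s =
     table_cost T1 \<theta>1 + prob \<theta>1 * attr_cost T1 a1 +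
     table_cost T2 (conj_filter (in_filter a2 (join_values T1 \<theta>1 a1) s) \<theta>2)"

end

theory Submission
  imports Defs
begin

text \<open>Plan 1 has the same expected cost as evaluating the IN filter after the whole of
  \<open>\<theta>\<close>: it is reached exactly when \<open>\<theta>\<close> is True. That is one of the orders over which
  the optimal cost of the transformed expression is minimised.\<close>

lemma min_order_cost_le:
  assumes "\<sigma> permutes {..<length cs}"
  shows "min_order_cost cs qs \<le> order_cost cs qs \<sigma>"
  unfolding min_order_cost_def using assms by (intro Min_le) (auto simp: finite_permutations)

lemma min_order_cost_attained:
  obtains \<sigma> where "\<sigma> permutes {..<length cs}" "min_order_cost cs qs = order_cost cs qs \<sigma>"
proof -
  let ?S = "{\<sigma>. \<sigma> permutes {..<length cs}}"
  have "finite ?S"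
    by (rule finite_permutations) simp
  moreover have "id \<in> ?S"
    by (simp add: permutes_id)
  ultimately have "min_order_cost cs qs \<in> order_cost cs qs ` ?S"
    unfolding min_order_cost_def by (intro Min_in) blast+
  then show ?thesis using that by blast
qed

text \<open>When a child is prepended to a list of \<open>n\<close> children, the old child
  \<open>k\<close> becomes number \<open>Suc k\<close> and the new one number 0. This map runs the
  old children in the order \<open>\<sigma>\<close> and the new one last; it fixes every
  \<open>i > n\<close>, as \<open>permutes\<close> demands.\<close>

lemma permutes_rotate_head_to_end:
  assumes "\<sigma> permutes {..<n}"
  shows "(\<lambda>i. if i < n then Suc (\<sigma> i) else if i = n then 0 else i) permutes {..<Suc n}"
    (is "?\<tau> permutes _")
proof (rule bij_imp_permutes)
  have "inj_on ?\<tau> {..<Suc n}"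
    using permutes_inj[OF assms] by (auto simp: inj_on_def)
  moreover have "?\<tau> ` {..<Suc n} \<subseteq> {..<Suc n}"
    using permutes_in_image[OF assms] by auto
  ultimately show "bij_betw ?\<tau> {..<Suc n} {..<Suc n}"
    unfolding bij_betw_def using endo_inj_surj[OF finite_lessThan] by metis
qed auto

text \<open>Used to see that the probability of reaching a child placed last is the same for every
  order of the others.\<close>

lemma prod_permuted_nth:
  fixes xs :: "'a :: comm_monoid_mult list"
  assumes "\<sigma> permutes {..<length xs}"
  shows "(\<Prod>j<length xs. xs ! \<sigma> j) = prod_list xs"
proof -
  have "(\<Prod>j<length xs. xs ! \<sigma> j) = (\<Prod>j<length xs. xs ! j)"
    using prod.permute[OF assms, of "(!) xs"] by (simp add: o_def)
  then show ?thesis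
    by (simp add: prod.list_conv_set_nth atLeast0LessThan)
qed

lemma min_order_cost_Cons_le:
  assumes "length qs = length cs"
  shows "min_order_cost (c # cs) (q # qs) \<le> min_order_cost cs qs + prod_list qs * c"
proof -
  obtain \<sigma> where \<sigma>: "\<sigma> permutes {..<length cs}"
    and opt: "min_order_cost cs qs = order_cost cs qs \<sigma>"
    by (rule min_order_cost_attained)
  define \<tau> where
    "\<tau> i = (if i < length cs then Suc (\<sigma> i) else if i = length cs then 0 else i)" for i
  have "\<tau> permutes {..<length (c # cs)}"
    using permutes_rotate_head_to_end[OF \<sigma>] by (simp add: \<tau>_def[abs_def])
  then have "min_order_cost (c # cs) (q # qs) \<le> order_cost (c # cs) (q # qs) \<tau>"
    by (rule min_order_cost_le)
  \<comment> \<open>The sum over \<open>Suc (length cs)\<close> positions splits off its last term,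
    where \<open>\<tau>\<close> picks index 0, that is \<open>c\<close>; at earlier positions the
    \<open>Suc\<close> in \<open>\<tau>\<close> skips the heads \<open>c\<close> and
    \<open>q\<close>.\<close>
  also have "\<dots> = order_cost cs qs \<sigma> + (\<Prod>j<length cs. qs ! \<sigma> j) * c"
    by (simp add: order_cost_def \<tau>_def)
  also have "(\<Prod>j<length cs. qs ! \<sigma> j) = prod_list qs"
    using prod_permuted_nth[of \<sigma> qs] \<sigma> assms by simp
  finally show ?thesis by (simp add: opt)
qed

lemma min_order_cost_singleton: "min_order_cost [c] [q] = c"
  by (simp add: min_order_cost_def order_cost_def lessThan_Suc)

text \<open>Under an AND root the filter joins the existing children, whose probabilities multiply
  to \<open>prob \<theta>\<close>. Any other root becomes the sole old child of a new AND node, and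
  a one-child list has only one order.\<close>

lemma opt_cost_conj_filter_le:
  "opt_cost T d (conj_filter f \<theta>) \<le> opt_cost T d \<theta> + prob \<theta> * ext_cost T d (attr f)"
proof (cases \<theta>)
  case (And es)
  then show ?thesis
    using min_order_cost_Cons_le[of "map prob es" "map (opt_cost T d) es"] by simp
next
  case (Leaf g)
  then show ?thesis
    using min_order_cost_Cons_le[of "[prob \<theta>]" "[opt_cost T d \<theta>]"]
    by (simp add: min_order_cost_singleton)
next
  case (Or es)
  then show ?thesis
    using min_order_cost_Cons_le[of "[prob \<theta>]" "[opt_cost T d \<theta>]"]
    by (simp add: min_order_cost_singleton)
qed

lemma table_cost_conj_filter_le:
  "table_cost T (conj_filter f \<theta>) \<le> table_cost T \<theta> + prob \<theta> * attr_cost T (attr f)"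
proof -
  have "table_cost T (conj_filter f \<theta>)
      \<le> (\<Sum>d\<leftarrow>docs T. opt_cost T d \<theta> + prob \<theta> * ext_cost T d (attr f))"
    \<comment> \<open>The optimal order may differ between documents, so the bound is taken document
      by document; \<open>prob \<theta>\<close> is common to all and factors out afterwards.\<close>
    unfolding table_cost_def by (intro sum_list_mono opt_cost_conj_filter_le)
  then show ?thesis
    by (simp add: table_cost_def attr_cost_def sum_list_addf sum_list_const_mult)
qed

theorem lemma2:
  fixes T1 :: "('d1, 'a1, 'val) table" and T2 :: "('d2, 'a2, 'val) table"
    and \<theta>1 :: "('a1, 'val) filter_expr" and \<theta>2 :: "('a2, 'val) filter_expr"
    and a :: 'a1 and a' :: 'a2
    and s1 s2 :: real
  assumes "is_table T1" and "is_table T2"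
    and "is_filter_expr \<theta>1" and "is_filter_expr \<theta>2"
    and "0 \<le> s1" and "s1 \<le> 1" and "0 \<le> s2" and "s2 \<le> 1"
  shows "cost_join T1 \<theta>1 a T2 \<theta>2 a' \<ge> cost_in T1 \<theta>1 a T2 \<theta>2 a' s2
       \<and> cost_join T1 \<theta>1 a T2 \<theta>2 a' \<ge> cost_in T2 \<theta>2 a' T1 \<theta>1 a s1"
  \<comment> \<open>In each inequality the terms of the table filtered first cancel. The IN filter
    inspects the join attribute, so the bound for the other table is exactly its share of
    \<open>cost_join\<close>.\<close>
  using table_cost_conj_filter_le[of T2 "in_filter a' (join_values T1 \<theta>1 a) s2" \<theta>2]
    table_cost_conj_filter_le[of T1 "in_filter a (join_values T2 \<theta>2 a') s1" \<theta>1]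
  by (simp add: cost_join_def cost_in_def in_filter_def)

end
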